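(* Let $a\neq 0$ and $n\ge 1$ be integers, and let $(x^*,y^* )$ be the fundamental solution of a class of integer solutions of the equation $$x^2-n(n+1)y^2=16a-n(n+1)$$ with $y^*$ odd. Let the sequence $(m_k)_{k\ge 1}$ be given by $$m_0=\tfrac12(y^*-1),\quad m_1=\tfrac12\bigl(2x^*+(2n+1)y^*-1\bigr),\quad m_k=2(2n+1)m_{k-1}-m_{k-2}+2n\ \ (k\ge 2).$$ Then for every $k\ge 1$ the number $T_{m_k}T_{m_{k+1}}+a$ is the square of a positive integer.
   Context: $T_j=\frac{j(j+1)}{2}$ (the $j$-th triangular number when $j$ is a positive integer; the same formula is used for every integer $j$). Put $d=n(n+1)$. Two integer solutions $(x,y)$ and $(x',y')$ of $x^2-dy^2=16a-d$ belong to the same class if $x'+y'\sqrt d=(x+y\sqrt d)(X+Y\sqrt d)$ for some integers $X,Y$ with $X^2-dY^2=1$. The fundamental solution $(x^*,y^* )$ of a class is the solution in the class with the smallest nonnegative value of $y$; if both $(x^*,y^* )$ and $(-x^*,y^* )$ lie in the class, the one with $x^*\ge 0$ is chosen. *)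

theory Defs
  imports Complex_Main
begin

definition triangular :: "int \<Rightarrow> int" where
  "triangular j = j * (j + 1) div 2"

lemma real_triangular: "real_of_int (triangular j) = real_of_int j * (real_of_int j + 1) / 2"
proof -
  have "2 * triangular j = j * (j + 1)"
    by (simp add: triangular_def)
  then have "real_of_int (2 * triangular j) = real_of_int (j * (j + 1))"
    by (rule arg_cong)
  then show ?thesis by simp
qed

definition pell_solutions :: "int \<Rightarrow> int \<Rightarrow> (int \<times> int) set" where
  "pell_solutions d N = {(x, y). x\<^sup>2 - d * y\<^sup>2 = N}"

definition same_class :: "int \<Rightarrow> int \<Rightarrow> ((int \<times> int) \<times> (int \<times> int)) set" where
  "same_class d N = {((x, y), (x', y')).
     (x, y) \<in> pell_solutions d N \<and> (x', y') \<in> pell_solutions d N \<and>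
     (\<exists>X Y :: int. X\<^sup>2 - d * Y\<^sup>2 = 1 \<and>
        real_of_int x' + real_of_int y' * sqrt (real_of_int d) =
        (real_of_int x + real_of_int y * sqrt (real_of_int d)) *
        (real_of_int X + real_of_int Y * sqrt (real_of_int d)))}"

lemma equiv_same_class:
  assumes "d \<ge> 0"
  shows "equiv (pell_solutions d N) (same_class d N)"
proof (rule equivI)
  have s: "sqrt (real_of_int d) * sqrt (real_of_int d) = real_of_int d"
    using assms by simp
  show "same_class d N \<subseteq> pell_solutions d N \<times> pell_solutions d N"
    by (auto simp: same_class_def)
  show "refl_on (pell_solutions d N) (same_class d N)"
  proof (rule refl_onI, clarify)
    fix x y
    assume "(x, y) \<in> pell_solutions d N"
    moreover have "(1 :: int)\<^sup>2 - d * 0\<^sup>2 = 1" by simp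
    moreover have "real_of_int x + real_of_int y * sqrt (real_of_int d) =
        (real_of_int x + real_of_int y * sqrt (real_of_int d)) *
        (real_of_int 1 + real_of_int 0 * sqrt (real_of_int d))" by simp
    ultimately show "((x, y), (x, y)) \<in> same_class d N"
      unfolding same_class_def by blast
  qed
  show "sym (same_class d N)"
  proof (rule symI, clarify)
    fix x y x' y'
    assume "((x, y), (x', y')) \<in> same_class d N"
    then obtain X Y where sol: "(x, y) \<in> pell_solutions d N" "(x', y') \<in> pell_solutions d N"
      and XY: "X\<^sup>2 - d * Y\<^sup>2 = 1"
      and eq: "real_of_int x' + real_of_int y' * sqrt (real_of_int d) =
        (real_of_int x + real_of_int y * sqrt (real_of_int d)) *
        (real_of_int X + real_of_int Y * sqrt (real_of_int d))"
      by (auto simp: same_class_def)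
    have "real_of_int (X\<^sup>2 - d * Y\<^sup>2) = 1" using XY by simp
    then have n: "(real_of_int X + real_of_int Y * sqrt (real_of_int d)) *
        (real_of_int X + real_of_int (- Y) * sqrt (real_of_int d)) = 1"
      using s by (simp add: algebra_simps power2_eq_square)
    have "real_of_int x + real_of_int y * sqrt (real_of_int d) =
        (real_of_int x' + real_of_int y' * sqrt (real_of_int d)) *
        (real_of_int X + real_of_int (- Y) * sqrt (real_of_int d))"
      unfolding eq mult.assoc n by simp
    moreover have "X\<^sup>2 - d * (- Y)\<^sup>2 = 1" using XY by simp
    ultimately show "((x', y'), (x, y)) \<in> same_class d N"
      using sol unfolding same_class_def by blast
  qed
  show "trans (same_class d N)"
  proof (rule transI, clarify)
    fix x y x' y' x'' y''
    assume a: "((x, y), (x', y')) \<in> same_class d N" "((x', y'), (x'', y'')) \<in> same_class d N"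
    then have sol: "(x, y) \<in> pell_solutions d N" "(x'', y'') \<in> pell_solutions d N"
      by (auto simp: same_class_def)
    from a(1) obtain X Y where XY: "X\<^sup>2 - d * Y\<^sup>2 = 1"
      and eq: "real_of_int x' + real_of_int y' * sqrt (real_of_int d) =
        (real_of_int x + real_of_int y * sqrt (real_of_int d)) *
        (real_of_int X + real_of_int Y * sqrt (real_of_int d))"
      by (auto simp: same_class_def)
    from a(2) obtain U V where UV: "U\<^sup>2 - d * V\<^sup>2 = 1"
      and eq': "real_of_int x'' + real_of_int y'' * sqrt (real_of_int d) =
        (real_of_int x' + real_of_int y' * sqrt (real_of_int d)) *
        (real_of_int U + real_of_int V * sqrt (real_of_int d))"
      by (auto simp: same_class_def)
    have "(X * U + d * Y * V)\<^sup>2 - d * (X * V + Y * U)\<^sup>2 = (X\<^sup>2 - d * Y\<^sup>2) * (U\<^sup>2 - d * V\<^sup>2)"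
      by algebra
    then have norm: "(X * U + d * Y * V)\<^sup>2 - d * (X * V + Y * U)\<^sup>2 = 1"
      using XY UV by simp
    have "(real_of_int X + real_of_int Y * sqrt (real_of_int d)) *
        (real_of_int U + real_of_int V * sqrt (real_of_int d)) =
        real_of_int X * real_of_int U + sqrt (real_of_int d) * sqrt (real_of_int d) * real_of_int Y * real_of_int V
        + (real_of_int X * real_of_int V + real_of_int Y * real_of_int U) * sqrt (real_of_int d)"
      by (simp only: algebra_simps)
    then have p: "(real_of_int X + real_of_int Y * sqrt (real_of_int d)) *
        (real_of_int U + real_of_int V * sqrt (real_of_int d)) =
        real_of_int (X * U + d * Y * V) + real_of_int (X * V + Y * U) * sqrt (real_of_int d)"
      unfolding s by simp
    have "real_of_int x'' + real_of_int y'' * sqrt (real_of_int d) =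
        (real_of_int x + real_of_int y * sqrt (real_of_int d)) *
        (real_of_int (X * U + d * Y * V) + real_of_int (X * V + Y * U) * sqrt (real_of_int d))"
      unfolding eq' eq mult.assoc p by simp
    with norm sol show "((x, y), (x'', y'')) \<in> same_class d N"
      unfolding same_class_def by blast
  qed
qed

definition is_fundamental_solution :: "(int \<times> int) set \<Rightarrow> int \<Rightarrow> int \<Rightarrow> bool" where
  "is_fundamental_solution C x y \<longleftrightarrow>
     (x, y) \<in> C \<and> y \<ge> 0 \<and>
     (\<forall>x' y'. (x', y') \<in> C \<and> y' \<ge> 0 \<longrightarrow> y \<le> y') \<and>
     ((- x, y) \<in> C \<longrightarrow> x \<ge> 0)"

(* The integer divisions by 2 are exact for odd y, the only case in which m_seq is used;
   see real_m_seq below. *)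
fun m_seq :: "int \<Rightarrow> int \<Rightarrow> int \<Rightarrow> nat \<Rightarrow> int" where
  "m_seq n x y 0 = (y - 1) div 2"
| "m_seq n x y (Suc 0) = (2 * x + (2 * n + 1) * y - 1) div 2"
| "m_seq n x y (Suc (Suc k)) =
     2 * (2 * n + 1) * m_seq n x y (Suc k) - m_seq n x y k + 2 * n"

lemma real_m_seq:
  assumes "odd y"
  shows "real_of_int (m_seq n x y 0) = (real_of_int y - 1) / 2"
    and "real_of_int (m_seq n x y 1) =
      (2 * real_of_int x + (2 * real_of_int n + 1) * real_of_int y - 1) / 2"
proof -
  from assms obtain z where z: "y = 2 * z + 1" by (auto elim: oddE)
  show "real_of_int (m_seq n x y 0) = (real_of_int y - 1) / 2"
    by (simp add: z)
  have "2 * x + (2 * n + 1) * y - 1 = 2 * (x + n * y + z)"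
    by (simp add: z algebra_simps)
  then have "m_seq n x y 1 = x + n * y + z"
    by simp
  then show "real_of_int (m_seq n x y 1) =
      (2 * real_of_int x + (2 * real_of_int n + 1) * real_of_int y - 1) / 2"
    by (simp add: z field_simps)
qed

end

theory Submission
  imports Defs
begin

text \<open>
  Put \<open>d = n (n + 1)\<close> and \<open>Y\<^sub>k = 2 m\<^sub>k + 1\<close>.  Then \<open>Y\<^sub>0 = y\<close>, \<open>Y\<^sub>1 = 2 x + (2 n + 1) y\<close>, and the
  recurrence for \<open>m\<close> becomes the homogeneous one \<open>Y\<^bsub>k+2\<^esub> = 2 (2 n + 1) Y\<^bsub>k+1\<^esub> - Y\<^sub>k\<close>: these are the
  second coordinates of \<open>(x + y \<surd>d) (2 n + 1 + 2 \<surd>d)\<^sup>k\<close>, where \<open>2 n + 1 + 2 \<surd>d\<close> is a unit of norm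
  \<open>1\<close>.

  The recurrence preserves the quadratic form \<open>Y\<^sub>k\<^sup>2 + Y\<^bsub>k+1\<^esub>\<^sup>2 - 2 (2 n + 1) Y\<^sub>k Y\<^bsub>k+1\<^esub>\<close>, whose value at
  \<open>k = 0\<close> is \<open>4 (x\<^sup>2 - d y\<^sup>2) = 64 a - 4 d\<close>.  Since \<open>8 T(m) = (2 m + 1)\<^sup>2 - 1\<close> and \<open>4 d + 1 = (2 n + 1)\<^sup>2\<close>,
  this invariant completes the square:
  \<open>64 (T(m\<^sub>k) T(m\<^bsub>k+1\<^esub>) + a) = (Y\<^sub>k\<^sup>2 - 1) (Y\<^bsub>k+1\<^esub>\<^sup>2 - 1) + 64 a = (Y\<^sub>k Y\<^bsub>k+1\<^esub> - (2 n + 1))\<^sup>2\<close>.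
  So \<open>T(m\<^sub>k) T(m\<^bsub>k+1\<^esub>) + a\<close> is a square, and it remains to see that it is not \<open>0\<close>.

  For \<open>a > 0\<close> this holds because triangular numbers are nonnegative.  For \<open>a < 0\<close> the norm
  \<open>16 a - d\<close> is negative, which forces \<open>Y\<^sub>1 > 0\<close>; as \<open>Y\<^sub>1\<close> belongs to a solution in the class of
  \<open>(x, y)\<close>, the minimality of \<open>y\<close> gives \<open>Y\<^sub>1 \<ge> Y\<^sub>0\<close>.  Hence \<open>Y\<close> is nondecreasing, and
  \<open>Y\<^sub>k Y\<^bsub>k+1\<^esub> > 2 n + 1\<close> for all \<open>k \<ge> 1\<close>.
\<close>

lemma eight_triangular: "8 * triangular j = (2 * j + 1)\<^sup>2 - 1"
proof -
  have "2 * triangular j = j * (j + 1)"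
    by (simp add: triangular_def)
  then show ?thesis
    by algebra
qed

lemma triangular_nonneg: "0 \<le> triangular j"
proof -
  have "0 \<le> j * (j + 1)"
    by (cases "j \<ge> 0") (auto simp: mult_nonpos_nonpos)
  then show ?thesis
    by (simp add: triangular_def)
qed

definition odd_seq :: "int \<Rightarrow> int \<Rightarrow> int \<Rightarrow> nat \<Rightarrow> int" where
  "odd_seq n x y k = 2 * m_seq n x y k + 1"

lemma odd_seq_0:
  assumes "odd y"
  shows "odd_seq n x y 0 = y"
  using assms by (simp add: odd_seq_def)

lemma odd_seq_1:
  assumes "odd y"
  shows "odd_seq n x y (Suc 0) = 2 * x + (2 * n + 1) * y"
proof -
  have "even (2 * x + (2 * n + 1) * y - 1)"
    using assms by simp
  then show ?thesis
    by (simp add: odd_seq_def)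
qed

lemma odd_seq_Suc_Suc:
  "odd_seq n x y (Suc (Suc k)) = 2 * (2 * n + 1) * odd_seq n x y (Suc k) - odd_seq n x y k"
  by (simp add: odd_seq_def algebra_simps)

text \<open>
  For fixed \<open>Y\<^bsub>k+1\<^esub>\<close> the left-hand side, as a quadratic polynomial in its other argument, takes the
  same value at \<open>Y\<^sub>k\<close> and at \<open>2 (2 n + 1) Y\<^bsub>k+1\<^esub> - Y\<^sub>k = Y\<^bsub>k+2\<^esub>\<close>, so it does not depend on \<open>k\<close>.
\<close>

lemma odd_seq_invariant:
  assumes "odd y"
  shows "(odd_seq n x y k)\<^sup>2 + (odd_seq n x y (Suc k))\<^sup>2
      - 2 * (2 * n + 1) * odd_seq n x y k * odd_seq n x y (Suc k)
    = 4 * (x\<^sup>2 - n * (n + 1) * y\<^sup>2)"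
proof (induction k)
  case 0
  show ?case
    unfolding odd_seq_0[OF assms] odd_seq_1[OF assms] by algebra
next
  case (Suc k)
  then show ?case
    unfolding odd_seq_Suc_Suc by algebra
qed

lemma triangular_product_square:
  assumes "odd y" and "x\<^sup>2 - n * (n + 1) * y\<^sup>2 = 16 * a - n * (n + 1)"
  shows "64 * (triangular (m_seq n x y k) * triangular (m_seq n x y (Suc k)) + a)
    = (odd_seq n x y k * odd_seq n x y (Suc k) - (2 * n + 1))\<^sup>2"
  using eight_triangular[of "m_seq n x y k"] eight_triangular[of "m_seq n x y (Suc k)"]
    odd_seq_invariant[OF assms(1), of n x k] assms(2)
  unfolding odd_seq_def[symmetric] by algebra

text \<open>
  With \<open>d = n (n + 1)\<close>, the second pair is \<open>(x + y \<surd>d) (2 n + 1 + 2 \<surd>d)\<close>, and the second factor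
  has norm \<open>(2 n + 1)\<^sup>2 - 4 d = 1\<close>.
\<close>

lemma same_class_unit_multiple:
  assumes "n \<ge> 0" and "(x, y) \<in> pell_solutions (n * (n + 1)) N"
  shows "((x, y), ((2 * n + 1) * x + 2 * n * (n + 1) * y, 2 * x + (2 * n + 1) * y))
    \<in> same_class (n * (n + 1)) N"
proof -
  let ?d = "n * (n + 1)"
  let ?x = "(2 * n + 1) * x + 2 * n * (n + 1) * y" and ?y = "2 * x + (2 * n + 1) * y"
  have unit: "(2 * n + 1)\<^sup>2 - ?d * 2\<^sup>2 = 1"
    by algebra
  have "?x\<^sup>2 - ?d * ?y\<^sup>2 = x\<^sup>2 - ?d * y\<^sup>2"
    by algebra
  then have sol: "(?x, ?y) \<in> pell_solutions ?d N"
    using assms(2) by (simp add: pell_solutions_def)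
  define r where "r = sqrt (real_of_int ?d)"
  have "r\<^sup>2 = real_of_int ?d"
    using assms(1) by (simp add: r_def)
  then have r: "r\<^sup>2 = real_of_int n * (real_of_int n + 1)"
    by simp
  have "real_of_int ?x + real_of_int ?y * r
      = (real_of_int x + real_of_int y * r) * (real_of_int (2 * n + 1) + real_of_int 2 * r)"
    using r by (simp, algebra)
  then show ?thesis
    using assms(2) sol unit unfolding same_class_def r_def by blast
qed

text \<open>
  A negative norm means \<open>\<bar>x\<bar> < y \<surd>d\<close>, so \<open>2 \<bar>x\<bar>\<close> is less than \<open>(2 n + 1) y\<close> and the unit multiple
  has a positive second coordinate, to which the minimality of \<open>y\<close> applies.
\<close>

lemma fundamental_solution_le_unit_multiple:
  assumes n: "n \<ge> 0" and N: "N < 0"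
    and C: "C \<in> pell_solutions (n * (n + 1)) N // same_class (n * (n + 1)) N"
    and fund: "is_fundamental_solution C x y"
  shows "y \<le> 2 * x + (2 * n + 1) * y"
proof -
  let ?d = "n * (n + 1)"
  have "?d \<ge> 0"
    using n by simp
  note E = equiv_same_class[OF this, of N]
  have mem: "(x, y) \<in> C" and y: "y \<ge> 0"
    and least: "\<And>x' y'. (x', y') \<in> C \<Longrightarrow> y' \<ge> 0 \<Longrightarrow> y \<le> y'"
    using fund by (auto simp: is_fundamental_solution_def)
  have sol: "(x, y) \<in> pell_solutions ?d N"
    using in_quotient_imp_subset[OF E C] mem by blast
  have in_C: "((2 * n + 1) * x + 2 * n * (n + 1) * y, 2 * x + (2 * n + 1) * y) \<in> C"
    using in_quotient_imp_closed[OF E C mem same_class_unit_multiple[OF n sol]] .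
  have "x\<^sup>2 - ?d * y\<^sup>2 < 0"
    using sol N by (simp add: pell_solutions_def)
  moreover have "((2 * n + 1) * y)\<^sup>2 = 4 * (?d * y\<^sup>2) + y\<^sup>2" "(- 2 * x)\<^sup>2 = 4 * x\<^sup>2"
    by algebra+
  ultimately have "(- 2 * x)\<^sup>2 < ((2 * n + 1) * y)\<^sup>2"
    using zero_le_power2[of y] by linarith
  moreover have "0 \<le> (2 * n + 1) * y"
    using n y by simp
  ultimately have "- 2 * x < (2 * n + 1) * y"
    using power2_less_imp_less by blast
  then show ?thesis
    using least[OF in_C] by simp
qed

lemma odd_seq_nondecreasing:
  assumes n: "n \<ge> 0" and "odd y" and "y \<ge> 0" and "y \<le> 2 * x + (2 * n + 1) * y"
  shows "1 \<le> odd_seq n x y k \<and> odd_seq n x y k \<le> odd_seq n x y (Suc k)"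
proof (induction k)
  case 0
  have "y \<noteq> 0"
    using \<open>odd y\<close> by auto
  then show ?case
    using assms by (simp add: odd_seq_0 odd_seq_1)
next
  case (Suc k)
  then have "0 \<le> n * odd_seq n x y (Suc k)"
    using n by simp
  then show ?case
    using Suc unfolding odd_seq_Suc_Suc by (simp add: algebra_simps)
qed

text \<open>
  Starting one index after the initial term makes the recurrence applicable, which gives
  \<open>Y\<^bsub>k+2\<^esub> = (4 n + 2) Y\<^bsub>k+1\<^esub> - Y\<^sub>k \<ge> (4 n + 1) Y\<^bsub>k+1\<^esub>\<close> with \<open>Y\<^bsub>k+1\<^esub> \<ge> 1\<close>.
\<close>

lemma odd_seq_product_gt:
  assumes n: "n \<ge> 1" and "odd y" and "y \<ge> 0" and "y \<le> 2 * x + (2 * n + 1) * y"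
  shows "2 * n + 1 < odd_seq n x y (Suc k) * odd_seq n x y (Suc (Suc k))"
proof -
  let ?u = "odd_seq n x y (Suc k)" and ?v = "odd_seq n x y (Suc (Suc k))"
  have bounds: "1 \<le> odd_seq n x y k" "odd_seq n x y k \<le> ?u"
    using odd_seq_nondecreasing[of n y x k] assms by auto
  then have u: "1 \<le> ?u"
    by linarith
  then have "n * 1 \<le> n * ?u"
    using n by (intro mult_left_mono) auto
  then have v: "4 * n + 1 \<le> ?v"
    using bounds u unfolding odd_seq_Suc_Suc by (simp add: algebra_simps)
  then have "1 * ?v \<le> ?u * ?v"
    using u n by (intro mult_right_mono) auto
  then show ?thesis
    using v n by linarith
qed

theorem proposition5:
  fixes a n x y :: int and C :: "(int \<times> int) set"
  assumes "a \<noteq> 0" and "n \<ge> 1"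
    and "C \<in> pell_solutions (n * (n + 1)) (16 * a - n * (n + 1))
             // same_class (n * (n + 1)) (16 * a - n * (n + 1))"
    and "is_fundamental_solution C x y"
    and "odd y"
  shows "\<forall>k\<ge>1. \<exists>s::int. s > 0 \<and>
    triangular (m_seq n x y k) * triangular (m_seq n x y (k + 1)) + a = s\<^sup>2"
proof (intro allI impI)
  fix k :: nat
  assume "k \<ge> 1"
  then obtain j where k: "k = Suc j"
    by (cases k) auto
  let ?d = "n * (n + 1)"
  let ?P = "triangular (m_seq n x y k) * triangular (m_seq n x y (k + 1)) + a"
  define z where "z = odd_seq n x y k * odd_seq n x y (Suc k) - (2 * n + 1)"
  have d: "?d \<ge> 0"
    using \<open>n \<ge> 1\<close> by simp
  have "(x, y) \<in> pell_solutions ?d (16 * a - ?d)"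
    using in_quotient_imp_subset[OF equiv_same_class[OF d] assms(3)] assms(4)
    by (auto simp: is_fundamental_solution_def)
  then have square: "64 * ?P = z\<^sup>2"
    using triangular_product_square[OF \<open>odd y\<close>, of x n a k]
    by (simp add: pell_solutions_def z_def)
  have "z \<noteq> 0"
  proof (cases "a > 0")
    case True
    then have "?P > 0"
      using triangular_nonneg by (simp add: add_nonneg_pos)
    then show ?thesis
      using square by auto
  next
    case False
    then have "16 * a - ?d < 0"
      using \<open>a \<noteq> 0\<close> d by linarith
    then have "y \<le> 2 * x + (2 * n + 1) * y"
      using fundamental_solution_le_unit_multiple[OF _ _ assms(3,4)] assms(2) by simp
    moreover have "y \<ge> 0"
      using assms(4) by (simp add: is_fundamental_solution_def)
    ultimately show ?thesis
      using odd_seq_product_gt[of n y x j] assms(2,5) by (simp add: z_def k)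
  qed
  have "8\<^sup>2 dvd z\<^sup>2"
    unfolding square[symmetric] by simp
  then have "8 dvd z"
    by (rule iffD1[OF pow_divides_pow_iff, rotated]) simp
  then obtain s where s: "z = 8 * s"
    by (rule dvdE)
  have "?P = \<bar>s\<bar>\<^sup>2"
    using square by (simp add: s power_mult_distrib)
  moreover have "\<bar>s\<bar> > 0"
    using \<open>z \<noteq> 0\<close> s by simp
  ultimately show "\<exists>s::int. s > 0 \<and> ?P = s\<^sup>2"
    by blast
qed

end
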